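(* Let $S$ be a finite semigroup. Then $\mathbf{C}(S)$ is a left zero semigroup (i.e. satisfies $xy=x$ for all $x,y$) if and only if $S^2=\{st:s,t\in S\}$ is the minimal ideal of $S$ and this ideal forms a right zero semigroup (i.e. satisfies $xy=y$ for all its elements $x,y$).
   Context: Cayley automaton semigroup: for a finite (non-empty) semigroup $S$, the Cayley automaton $\mathcal{C}(S)$ has state set $S$ and alphabet $S$; when in state $s$ (written $\overline{s}$ to distinguish states from symbols) and reading a symbol $t$, it outputs $st$ and moves to state $\overline{st}$. Thus each state defines a transformation $\overline{s}$ of the set $S^{\infty}$ of infinite sequences over $S$, given by $(x_1,x_2,x_3,\ldots)\cdot\overline{s}=(sx_1,\,sx_1x_2,\,sx_1x_2x_3,\ldots)$. Transformations act on the right and are composed left to right: $\alpha\cdot(\overline{s}\cdot\overline{t})=(\alpha\cdot\overline{s})\cdot\overline{t}$. $\mathbf{C}(S)$ is the semigroup of transformations of $S^{\infty}$ generated by $\{\overline{s}:s\in S\}$. *)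

theory Defs
  imports Main
begin

text \<open>A semigroup \<open>S\<close> is a type of class \<open>semigroup_mult\<close>. Infinite sequences over \<open>S\<close> are
  functions from \<open>nat\<close>, so \<open>(x\<^sub>1, x\<^sub>2, \<dots>)\<close> is indexed from 0 here.\<close>

primrec mealy_state :: "('q \<Rightarrow> 'b \<Rightarrow> 'q) \<Rightarrow> 'q \<Rightarrow> (nat \<Rightarrow> 'b) \<Rightarrow> nat \<Rightarrow> 'q" where
  "mealy_state nxt q x 0 = q"
| "mealy_state nxt q x (Suc n) = nxt (mealy_state nxt q x n) (x n)"

definition mealy_action ::
    "('q \<Rightarrow> 'b \<Rightarrow> 'q) \<Rightarrow> ('q \<Rightarrow> 'b \<Rightarrow> 'c) \<Rightarrow> 'q \<Rightarrow> (nat \<Rightarrow> 'b) \<Rightarrow> (nat \<Rightarrow> 'c)" where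
  "mealy_action nxt out q x = (\<lambda>n. out (mealy_state nxt q x n) (x n))"

text \<open>In the Cayley automaton both the next state and the output, in state \<open>s\<close> on symbol \<open>t\<close>,
  are \<open>s * t\<close>.\<close>

definition cayley_action :: "'a::semigroup_mult \<Rightarrow> (nat \<Rightarrow> 'a) \<Rightarrow> (nat \<Rightarrow> 'a)" where
  "cayley_action s = mealy_action (*) (*) s"

text \<open>The two equations below say that \<open>s\<close> sends \<open>(x\<^sub>1, x\<^sub>2, x\<^sub>3, \<dots>)\<close> to
  \<open>(s x\<^sub>1, s x\<^sub>1 x\<^sub>2, s x\<^sub>1 x\<^sub>2 x\<^sub>3, \<dots>)\<close>.\<close>

lemma cayley_action_0: "cayley_action s x 0 = s * x 0"
  by (simp add: cayley_action_def mealy_action_def)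

lemma cayley_action_Suc: "cayley_action s x (Suc n) = cayley_action s x n * x (Suc n)"
  by (simp add: cayley_action_def mealy_action_def)

text \<open>Transformations act on the right, so the product \<open>f g\<close> applies \<open>f\<close> first.\<close>

definition rcomp :: "('x \<Rightarrow> 'x) \<Rightarrow> ('x \<Rightarrow> 'x) \<Rightarrow> ('x \<Rightarrow> 'x)" where
  "rcomp f g = (\<lambda>\<alpha>. g (f \<alpha>))"

inductive_set generated_semigroup :: "('b \<Rightarrow> 'b \<Rightarrow> 'b) \<Rightarrow> 'b set \<Rightarrow> 'b set"
  for mult :: "'b \<Rightarrow> 'b \<Rightarrow> 'b" and X :: "'b set" where
  gen: "x \<in> X \<Longrightarrow> x \<in> generated_semigroup mult X"
| mult: "x \<in> generated_semigroup mult X \<Longrightarrow> y \<in> generated_semigroup mult X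
         \<Longrightarrow> mult x y \<in> generated_semigroup mult X"

definition cayley_semigroup :: "((nat \<Rightarrow> 'a::semigroup_mult) \<Rightarrow> (nat \<Rightarrow> 'a)) set" where
  "cayley_semigroup = generated_semigroup rcomp (range cayley_action)"

text \<open>Closure under \<open>mult\<close> and associativity on \<open>A\<close> follow from either of the next two laws.\<close>

definition left_zero_semigroup :: "('b \<Rightarrow> 'b \<Rightarrow> 'b) \<Rightarrow> 'b set \<Rightarrow> bool" where
  "left_zero_semigroup mult A \<longleftrightarrow> (\<forall>x\<in>A. \<forall>y\<in>A. mult x y = x)"

definition right_zero_semigroup :: "('b \<Rightarrow> 'b \<Rightarrow> 'b) \<Rightarrow> 'b set \<Rightarrow> bool" where
  "right_zero_semigroup mult A \<longleftrightarrow> (\<forall>x\<in>A. \<forall>y\<in>A. mult x y = y)"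

definition semigroup_ideal :: "'a::semigroup_mult set \<Rightarrow> bool" where
  "semigroup_ideal I \<longleftrightarrow> I \<noteq> {} \<and> (\<forall>s. \<forall>x\<in>I. s * x \<in> I \<and> x * s \<in> I)"

text \<open>Two ideals always meet (in their product), so an inclusion-minimal ideal is the unique one
  and is contained in every ideal.\<close>

definition minimal_ideal :: "'a::semigroup_mult set \<Rightarrow> bool" where
  "minimal_ideal I \<longleftrightarrow> semigroup_ideal I \<and> (\<forall>J. semigroup_ideal J \<and> J \<subseteq> I \<longrightarrow> J = I)"

end

theory Submission
  imports Defs
begin

text \<open>Both sides are equivalent to the law \<open>t * (s * x) = s * x\<close>, that is, every element of \<open>S\<^sup>2\<close> is
  a right zero of \<open>S\<close>. Every entry of a sequence in the image of \<open>\<^bold>C(S)\<close> lies in \<open>S\<^sup>2\<close>, so under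
  this law every generator fixes such sequences; conversely, the law is read off the first entry.\<close>

lemma cayley_action_in_square: "\<exists>a b. cayley_action s x n = a * b"
  by (cases n) (auto simp: cayley_action_0 cayley_action_Suc)

lemma cayley_semigroup_in_square:
  assumes "f \<in> cayley_semigroup"
  shows "\<exists>a b. f x n = a * b"
  using assms[unfolded cayley_semigroup_def]
  \<comment> \<open>The input \<open>x\<close> varies because in a product the second factor acts on
    the image of \<open>x\<close> under the first.\<close>
  by (induction arbitrary: x) (auto simp: rcomp_def cayley_action_in_square)

text \<open>Each output becomes the next state, and any state multiplies the entry it reads to that
  same entry.\<close>

lemma cayley_action_fixes:
  fixes y :: "nat \<Rightarrow> 'a::semigroup_mult"
  assumes "\<And>s n. s * y n = y n"
  shows "cayley_action t y = y"
proof
  show "cayley_action t y n = y n" for n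
    by (induction n) (simp_all add: cayley_action_0 cayley_action_Suc assms)
qed

lemma left_zero_cayley_semigroup_iff:
  "left_zero_semigroup rcomp (cayley_semigroup :: ((nat \<Rightarrow> 'a::semigroup_mult) \<Rightarrow> _) set)
    \<longleftrightarrow> (\<forall>t s x :: 'a. t * (s * x) = s * x)"
proof
  assume L: "left_zero_semigroup rcomp (cayley_semigroup :: ((nat \<Rightarrow> 'a) \<Rightarrow> _) set)"
  have gen: "cayley_action s \<in> cayley_semigroup" for s :: 'a
    unfolding cayley_semigroup_def by (simp add: generated_semigroup.gen)
  show "\<forall>t s x :: 'a. t * (s * x) = s * x"
  proof (intro allI)
    fix t s x :: 'a
    have "rcomp (cayley_action s) (cayley_action t) = cayley_action s"
      using L gen unfolding left_zero_semigroup_def by blast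
    \<comment> \<open>Entry 0 depends only on the first input symbol, so a constant sequence
      suffices.\<close>
    then have "rcomp (cayley_action s) (cayley_action t) (\<lambda>_. x) 0 = cayley_action s (\<lambda>_. x) 0"
      by simp
    then show "t * (s * x) = s * x"
      by (simp add: rcomp_def cayley_action_0)
  qed
next
  assume law: "\<forall>t s x :: 'a. t * (s * x) = s * x"
  have "rcomp f g = f"
    if f: "f \<in> cayley_semigroup" and g: "g \<in> cayley_semigroup"
    for f g :: "(nat \<Rightarrow> 'a) \<Rightarrow> (nat \<Rightarrow> 'a)"
    \<comment> \<open>Only \<open>g\<close> is decomposed, with \<open>f\<close> fixed: once
      \<open>g\<close> and \<open>h\<close> both fix the image of \<open>f\<close>, so does their
      product.\<close>
    using g[unfolded cayley_semigroup_def]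
  proof induction
    case (gen g)
    then obtain t where t: "g = cayley_action t" by blast
    have "s * f x n = f x n" for s x n
      using cayley_semigroup_in_square[OF f] law by metis
    then show ?case
      unfolding t rcomp_def by (simp add: cayley_action_fixes)
  next
    case (mult g h)
    then show ?case unfolding rcomp_def by metis
  qed
  then show "left_zero_semigroup rcomp (cayley_semigroup :: ((nat \<Rightarrow> 'a) \<Rightarrow> _) set)"
    unfolding left_zero_semigroup_def by blast
qed

text \<open>For the forward direction, \<open>u = s * x\<close> is idempotent, so
  \<open>t * u = (t * u) * u\<close>, where both factors now lie in the square.\<close>

lemma right_zero_square_iff:
  "right_zero_semigroup (*) {s * t | s t :: 'a::semigroup_mult. True}
    \<longleftrightarrow> (\<forall>t s x :: 'a. t * (s * x) = s * x)"
proof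
  assume "right_zero_semigroup (*) {s * t | s t :: 'a. True}"
  then have R: "(a * b) * (c * d) = c * d" for a b c d :: 'a
    unfolding right_zero_semigroup_def by blast
  show "\<forall>t s x :: 'a. t * (s * x) = s * x"
  proof (intro allI)
    fix t s x :: 'a
    have "t * (s * x) = t * ((s * x) * (s * x))" by (simp only: R)
    also have "\<dots> = (t * (s * x)) * (s * x)" by (simp only: mult.assoc)
    also have "\<dots> = s * x" by (rule R)
    finally show "t * (s * x) = s * x" .
  qed
qed (auto simp: right_zero_semigroup_def)

lemma minimal_ideal_square:
  assumes law: "\<And>t s x :: 'a::semigroup_mult. t * (s * x) = s * x"
  shows "minimal_ideal {s * t | s t :: 'a. True}"
proof -
  have "semigroup_ideal {s * t | s t :: 'a. True}"
    unfolding semigroup_ideal_def by blast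
  moreover have "u \<in> J" if "semigroup_ideal J" "u = s * t" for J and u s t :: 'a
  proof -
    \<comment> \<open>By the law \<open>j * u\<close> equals \<open>u\<close>, so any ideal absorbs
      the whole square.\<close>
    obtain j where "j \<in> J" "j * u \<in> J"
      using \<open>semigroup_ideal J\<close> unfolding semigroup_ideal_def by blast
    then show ?thesis using law \<open>u = s * t\<close> by simp
  qed
  ultimately show ?thesis
    unfolding minimal_ideal_def by blast
qed

theorem proposition1p6:
  "left_zero_semigroup rcomp
      (cayley_semigroup :: ((nat \<Rightarrow> 'a::{semigroup_mult, finite}) \<Rightarrow> (nat \<Rightarrow> 'a)) set)
    \<longleftrightarrow> minimal_ideal {s * t | s t :: 'a. True}
        \<and> right_zero_semigroup (*) {s * t | s t :: 'a. True}"
  unfolding left_zero_cayley_semigroup_iff right_zero_square_iff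
  using minimal_ideal_square by blast

end
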